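(* Let $H$ be a separable Hilbert space and let $\{x_n\}_{n\in\mathbb{N}}\subseteq H$ be a sequence of nonzero elements for which $\|x_n\|\to 0$ as $n\to\infty$. Assume that there exists an infinite-dimensional closed subspace $M$ of $H$ such that $\{P_Mx_n\}$ satisfies a lower frame condition for $M$. Then $\{x_n\}$ is not Bessel-normalizable.
   Context: $P_M$ is the orthogonal projection of $H$ onto $M$. A sequence $\{z_n\}$ in a Hilbert space $K$ satisfies a lower frame condition for $K$ if there is $A>0$ with $\sum_n|\langle x,z_n\rangle|^2\ge A\|x\|^2$ for all $x\in K$ (the sum being allowed to be $+\infty$); it is a Bessel sequence in $K$ if there is a constant $B$ with $\sum_n|\langle x,z_n\rangle|^2\le B\|x\|^2$ for all $x\in K$. A sequence $\{x_n\}$ of nonzero elements of $H$ is Bessel-normalizable if $\{x_n/\|x_n\|\}$ is a Bessel sequence in $H$. *)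

theory Defs
  imports "HOL-Analysis.Analysis"
begin

(* Scalars.  HOL-Analysis has only real inner products, so real and complex Hilbert spaces
   are treated together by abstracting over the scalar field.  By Gelfand-Mazur the models
   of this class are, up to isomorphism, the real and the complex numbers, and the last axiom
   forces scnj to be the usual conjugation. *)

class real_or_complex = real_normed_field +
  fixes scnj :: "'a \<Rightarrow> 'a"
  assumes scnj_add: "scnj (a + b) = scnj a + scnj b"
    and scnj_mult: "scnj (a * b) = scnj a * scnj b"
    and scnj_scnj: "scnj (scnj a) = a"
    and mult_scnj: "a * scnj a = (norm a)\<^sup>2 *\<^sub>R 1"

instantiation real :: real_or_complex
begin
definition scnj_real :: "real \<Rightarrow> real" where "scnj_real a = a"
instance by standard (simp_all add: scnj_real_def power2_eq_square)
end

instantiation complex :: real_or_complex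
begin
definition scnj_complex :: "complex \<Rightarrow> complex" where "scnj_complex = cnj"
instance by standard (simp_all add: scnj_complex_def complex_norm_square[symmetric] scaleR_conv_of_real)
end

(* Completeness, and the agreement of the topology with the norm, come from the sort banach
   of the vectors. *)

locale hilbert_space = vector_space scl
  for scl :: "'k::real_or_complex \<Rightarrow> 'h::banach \<Rightarrow> 'h" +
  fixes ip :: "'h \<Rightarrow> 'h \<Rightarrow> 'k"
  assumes scale_of_real: "scl (of_real r) x = r *\<^sub>R x"
    and ip_add_left: "ip (x + y) z = ip x z + ip y z"
    and ip_scale_left: "ip (scl a x) y = a * ip x y"
    and ip_commute: "ip y x = scnj (ip x y)"
    and ip_self: "ip x x = of_real ((norm x)\<^sup>2)"

lemma hilbert_space_real_inner:
  "hilbert_space scaleR ((\<bullet>) :: 'h::{real_inner,banach} \<Rightarrow> 'h \<Rightarrow> real)"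
  by unfold_locales
    (simp_all add: scnj_real_def inner_commute power2_norm_eq_inner algebra_simps)

lemma hilbert_space_complex:
  "hilbert_space (*) (\<lambda>x y :: complex. x * cnj y)"
  by unfold_locales
    (simp_all add: scnj_complex_def scaleR_conv_of_real complex_norm_square[symmetric] algebra_simps)

definition infinite_dimensional ::
  "('k::field \<Rightarrow> 'h::ab_group_add \<Rightarrow> 'h) \<Rightarrow> 'h set \<Rightarrow> bool" where
  "infinite_dimensional scl M \<longleftrightarrow> \<not> (\<exists>B. finite B \<and> B \<subseteq> M \<and> M = module.span scl B)"

(* The description is proper whenever M is a closed subspace of a Hilbert space. *)

definition orth_proj :: "('h \<Rightarrow> 'h \<Rightarrow> 'k::zero) \<Rightarrow> 'h::minus set \<Rightarrow> 'h \<Rightarrow> 'h" where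
  "orth_proj ip M x = (THE m. m \<in> M \<and> (\<forall>y\<in>M. ip (x - m) y = 0))"

(* In the next two definitions K is the carrier of a closed subspace, regarded as a Hilbert
   space with the inherited inner product; the sums of nonnegative terms are taken in ereal,
   where they always exist and may be infinite. *)

definition lower_frame_condition ::
  "('h \<Rightarrow> 'h \<Rightarrow> 'k::real_normed_vector) \<Rightarrow> 'h::real_normed_vector set \<Rightarrow> (nat \<Rightarrow> 'h) \<Rightarrow> bool" where
  "lower_frame_condition ip K z \<longleftrightarrow> range z \<subseteq> K \<and>
     (\<exists>A::real. A > 0 \<and>
       (\<forall>x\<in>K. (\<Sum>n. ereal ((norm (ip x (z n)))\<^sup>2)) \<ge> ereal (A * (norm x)\<^sup>2)))"

definition bessel_sequence ::
  "('h \<Rightarrow> 'h \<Rightarrow> 'k::real_normed_vector) \<Rightarrow> 'h::real_normed_vector set \<Rightarrow> (nat \<Rightarrow> 'h) \<Rightarrow> bool" where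
  "bessel_sequence ip K z \<longleftrightarrow> range z \<subseteq> K \<and>
     (\<exists>B::real.
       (\<forall>x\<in>K. (\<Sum>n. ereal ((norm (ip x (z n)))\<^sup>2)) \<le> ereal (B * (norm x)\<^sup>2)))"

(* Only meaningful for sequences of nonzero elements. *)

definition bessel_normalizable ::
  "('h \<Rightarrow> 'h \<Rightarrow> 'k::real_normed_vector) \<Rightarrow> (nat \<Rightarrow> 'h::real_normed_vector) \<Rightarrow> bool" where
  "bessel_normalizable ip x \<longleftrightarrow> bessel_sequence ip UNIV (\<lambda>n. x n /\<^sub>R norm (x n))"

end

theory Submission
  imports Defs
begin

text \<open>
  Suppose the normalized sequence is Bessel with bound \<open>B\<close>, and let \<open>A\<close> be the lower frame bound on
  \<open>M\<close>. As the norms tend to zero, some tail of the sequence satisfies \<open>B \<parallel>x\<^sub>n\<parallel>\<^sup>2 \<le> A / 2\<close>. Since \<open>M\<close> is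
  infinite-dimensional, it contains a nonzero \<open>y\<close> orthogonal to the finitely many remaining \<open>x\<^sub>n\<close>.
  Only the tail contributes to \<open>\<Sum>\<bar>\<langle>y, x\<^sub>n\<rangle>\<bar>\<^sup>2\<close>, which is therefore at most \<open>(A / 2) \<parallel>y\<parallel>\<^sup>2\<close>;
  this contradicts the lower frame condition because \<open>\<langle>y, P\<^sub>M x\<^sub>n\<rangle> = \<langle>y, x\<^sub>n\<rangle>\<close>.
\<close>

section \<open>Conjugation and sesquilinearity\<close>

lemma scnj_0: "scnj (0::'a::real_or_complex) = 0"
  using scnj_add[of "0::'a" 0] by simp

text \<open>By \<open>mult_scnj\<close>, a nonzero real scalar times its conjugate equals its own
  square, so the scalar can be cancelled.\<close>

lemma scnj_of_real: "scnj (of_real r :: 'a::real_or_complex) = of_real r"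
proof (cases "r = 0")
  case False
  have "of_real r * scnj (of_real r :: 'a) = of_real r * of_real r"
    using mult_scnj[of "of_real r :: 'a"] by (simp add: scaleR_conv_of_real power2_eq_square)
  then show ?thesis
    using False by simp
qed (simp add: scnj_0)

context hilbert_space
begin

lemma ip_minus_left: "ip (- x) y = - ip x y"
  using ip_scale_left[of "-1" x y] by simp

lemma ip_diff_left: "ip (x - y) z = ip x z - ip y z"
  using ip_add_left[of x "- y" z] by (simp add: ip_minus_left)

lemma ip_zero_left: "ip 0 y = 0"
  using ip_diff_left[of 0 0 y] by simp

lemma ip_add_right: "ip x (y + z) = ip x y + ip x z"
  using ip_commute ip_add_left scnj_add by metis

lemma ip_diff_right: "ip x (y - z) = ip x y - ip x z"
  using ip_add_right[of x "y - z" z] by simp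

lemma ip_scale_right: "ip x (scl a y) = scnj a * ip x y"
  using ip_commute ip_scale_left scnj_mult by metis

lemma ip_eq_0_commute: "ip x y = 0 \<longleftrightarrow> ip y x = 0"
  using ip_commute scnj_0 by metis

lemma norm_ip_scaleR_right: "norm (ip x (r *\<^sub>R y)) = \<bar>r\<bar> * norm (ip x y)"
  using ip_scale_right[of x "of_real r" y]
  by (simp add: scale_of_real scnj_of_real norm_mult)

section \<open>Closest points and orthogonal projection\<close>

lemma parallelogram_law:
  fixes x y :: 'h
  shows "(norm (x + y))\<^sup>2 + (norm (x - y))\<^sup>2 = 2 * (norm x)\<^sup>2 + 2 * (norm y)\<^sup>2"
proof -
  have "ip (x + y) (x + y) + ip (x - y) (x - y) = 2 * ip x x + 2 * ip y y"
    by (simp add: ip_add_left ip_add_right ip_diff_left ip_diff_right)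
  then have "(of_real ((norm (x + y))\<^sup>2 + (norm (x - y))\<^sup>2) :: 'k)
      = of_real (2 * (norm x)\<^sup>2 + 2 * (norm y)\<^sup>2)"
    by (simp add: ip_self)
  then show ?thesis
    by (simp only: of_real_eq_iff)
qed

text \<open>Pythagoras: removing the component of \<open>u\<close> along \<open>y\<close> leaves a
  vector orthogonal to \<open>y\<close>. The exact drop in the squared norm is what forces a closest
  point to have an orthogonal residual.\<close>

lemma norm_diff_projection:
  assumes "y \<noteq> 0"
  shows "(norm (u - scl (ip u y / of_real ((norm y)\<^sup>2)) y))\<^sup>2
           = (norm u)\<^sup>2 - (norm (ip u y))\<^sup>2 / (norm y)\<^sup>2"
proof -
  define a where "a = ip u y"
  \<comment> \<open>Splitting off the real factor \<open>r\<close>, which conjugation fixes, brings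
    both cross terms and the square term to multiples of \<open>a * scnj a\<close>.\<close>
  define r where "r = 1 / (norm y)\<^sup>2"
  define c where "c = of_real r * a"
  have r: "r * (norm y)\<^sup>2 = 1"
    using assms by (simp add: r_def)
  have cc: "a * scnj a = of_real ((norm a)\<^sup>2)"
    by (simp add: mult_scnj scaleR_conv_of_real)
  have "ip (u - scl c y) (u - scl c y)
      = ip u u - c * scnj a - scnj c * a + c * scnj c * ip y y"
    using ip_commute[of u y]
    by (simp add: ip_diff_left ip_diff_right ip_scale_left ip_scale_right a_def scnj_scnj
        algebra_simps)
  also have "\<dots> = ip u u - of_real r * (a * scnj a) - of_real r * (a * scnj a)
      + of_real r * (a * scnj a) * of_real (r * (norm y)\<^sup>2)"
    by (simp add: c_def scnj_mult scnj_of_real ip_self algebra_simps)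
  also have "\<dots> = of_real ((norm u)\<^sup>2 - r * (norm a)\<^sup>2)"
    by (simp only: r cc ip_self) simp
  finally have "(norm (u - scl c y))\<^sup>2 = (norm u)\<^sup>2 - r * (norm a)\<^sup>2"
    by (simp only: ip_self of_real_eq_iff)
  then show ?thesis
    by (simp add: c_def r_def a_def)
qed

text \<open>The near-minimizers \<open>S n\<close> form nested closed nonempty sets whose diameters
  tend to 0 by the parallelogram law; completeness gives a common point.\<close>

lemma closest_point_exists:
  assumes "subspace M" "closed M"
  shows "\<exists>m\<in>M. \<forall>y\<in>M. norm (x - m) \<le> norm (x - y)"
proof -
  define d where "d = (INF m\<in>M. (norm (x - m))\<^sup>2)"
  define S where "S n = {m \<in> M. (norm (x - m))\<^sup>2 \<le> d + inverse (real (Suc n))}" for n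
  have ne: "M \<noteq> {}"
    using subspace_0[OF assms(1)] by blast
  have bdd: "bdd_below ((\<lambda>m. (norm (x - m))\<^sup>2) ` M)"
    by (rule bdd_belowI2[of _ 0]) simp
  have d_le: "d \<le> (norm (x - m))\<^sup>2" if "m \<in> M" for m
    unfolding d_def using bdd that by (rule cINF_lower)
  have diam: "(norm (a - b))\<^sup>2 \<le> 4 * inverse (real (Suc n))" if "a \<in> S n" "b \<in> S n" for a b n
  proof -
    \<comment> \<open>The midpoint lies in \<open>M\<close>, so its squared distance to
      \<open>x\<close> is at least \<open>d\<close>; this bounds the first term of the parallelogram
      law from below by \<open>4 * d\<close>.\<close>
    have "scl (of_real (1/2)) (a + b) \<in> M"
      using that assms(1) by (auto simp: S_def intro: subspace_scale subspace_add)
    then have "d \<le> (norm (x - (1/2) *\<^sub>R (a + b)))\<^sup>2"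
      using d_le by (simp only: scale_of_real)
    moreover have "(x - a) + (x - b) = 2 *\<^sub>R (x - (1/2) *\<^sub>R (a + b))"
      by (simp add: algebra_simps scaleR_2)
    then have "(norm ((x - a) + (x - b)))\<^sup>2 = 4 * (norm (x - (1/2) *\<^sub>R (a + b)))\<^sup>2"
      by (simp add: power_mult_distrib)
    ultimately have "4 * d + (norm (b - a))\<^sup>2 \<le> 2 * (norm (x - a))\<^sup>2 + 2 * (norm (x - b))\<^sup>2"
      using parallelogram_law[of "x - a" "x - b"] by simp
    then show ?thesis
      using that by (simp add: S_def norm_minus_commute)
  qed
  have "\<exists>a. \<forall>n. a \<in> S n"
  proof (rule decreasing_closed_nest[of S])
    show "closed (S n)" for n
    proof -
      have "S n = M \<inter> {m. (norm (x - m))\<^sup>2 \<le> d + inverse (real (Suc n))}"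
        by (auto simp: S_def)
      then show ?thesis
        using assms(2) by (auto intro!: closed_Int closed_Collect_le continuous_intros)
    qed
    show "S n \<noteq> {}" for n
    proof -
      have "\<exists>m\<in>M. (norm (x - m))\<^sup>2 < d + inverse (real (Suc n))"
        using cINF_less_iff[OF ne bdd, of "d + inverse (real (Suc n))"] by (simp add: d_def)
      then show ?thesis
        by (force simp: S_def)
    qed
    show "S n \<subseteq> S m" if "m \<le> n" for m n
    proof -
      have "d + inverse (real (Suc n)) \<le> d + inverse (real (Suc m))"
        using that by (intro add_left_mono le_imp_inverse_le) auto
      then show ?thesis
        unfolding S_def by (intro Collect_mono impI conjI) (elim conjE, assumption, linarith)
    qed
    show "\<exists>n. \<forall>a\<in>S n. \<forall>b\<in>S n. dist a b < e" if "0 < e" for e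
    proof -
      have "0 < e\<^sup>2 / 4"
        using that by simp
      then obtain n where n: "inverse (real (Suc n)) < e\<^sup>2 / 4"
        using reals_Archimedean by blast
      have "dist a b < e" if "a \<in> S n" "b \<in> S n" for a b
        using diam[OF that] n \<open>0 < e\<close>
        by (intro power2_less_imp_less[of _ e]) (auto simp: dist_norm)
      then show ?thesis
        by blast
    qed
  qed auto
  then obtain m where m: "\<And>n. m \<in> S n"
    by blast
  have "(norm (x - m))\<^sup>2 \<le> d"
  proof (rule field_le_epsilon)
    fix e :: real
    assume "0 < e"
    then obtain n where "inverse (real (Suc n)) < e"
      using reals_Archimedean by blast
    then show "(norm (x - m))\<^sup>2 \<le> d + e"
      using m[of n] by (simp add: S_def)
  qed
  then have "(norm (x - m))\<^sup>2 \<le> (norm (x - y))\<^sup>2" if "y \<in> M" for y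
    using d_le[OF that] by (rule order_trans)
  then have "norm (x - m) \<le> norm (x - y)" if "y \<in> M" for y
    using that power2_le_imp_le norm_ge_zero by blast
  moreover have "m \<in> M"
    using m[of 0] by (simp add: S_def)
  ultimately show ?thesis
    by blast
qed

text \<open>At a closest point \<open>m\<close>, moving along \<open>y\<close> by the projection
  coefficient \<open>c\<close> stays in \<open>M\<close> and would shorten the residual unless its
  inner product with \<open>y\<close> vanishes.\<close>

lemma orth_proj_exists:
  assumes "subspace M" "closed M"
  shows "\<exists>m\<in>M. \<forall>y\<in>M. ip (x - m) y = 0"
proof -
  obtain m where m: "m \<in> M" and min: "\<And>y. y \<in> M \<Longrightarrow> norm (x - m) \<le> norm (x - y)"
    using closest_point_exists[OF assms] by blast
  have "ip (x - m) y = 0" if "y \<in> M" for y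
  proof (cases "y = 0")
    case True
    then show ?thesis
      using ip_zero_left ip_eq_0_commute by blast
  next
    case False
    define c where "c = ip (x - m) y / of_real ((norm y)\<^sup>2)"
    have "m + scl c y \<in> M"
      using m that assms(1) by (intro subspace_add subspace_scale)
    then have "(norm (x - m))\<^sup>2 \<le> (norm (x - m - scl c y))\<^sup>2"
      using min[of "m + scl c y"] by (intro power_mono) (simp_all add: diff_diff_add)
    then have "(norm (ip (x - m) y))\<^sup>2 / (norm y)\<^sup>2 \<le> 0"
      using norm_diff_projection[OF False, of "x - m"] unfolding c_def by linarith
    then show ?thesis
      using False by (simp add: divide_le_0_iff)
  qed
  then show ?thesis
    using m by blast
qed

lemma ip_orth_proj:
  assumes "subspace M" "closed M" "y \<in> M"
  shows "ip y (orth_proj ip M x) = ip y x"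
proof -
  have "\<exists>!m. m \<in> M \<and> (\<forall>y\<in>M. ip (x - m) y = 0)"
  proof (rule ex_ex1I)
    show "\<exists>m. m \<in> M \<and> (\<forall>y\<in>M. ip (x - m) y = 0)"
      using orth_proj_exists[OF assms(1,2)] by blast
    fix m m'
    assume *: "m \<in> M \<and> (\<forall>y\<in>M. ip (x - m) y = 0)" "m' \<in> M \<and> (\<forall>y\<in>M. ip (x - m') y = 0)"
    then have "m' - m \<in> M"
      using assms(1) by (blast intro: subspace_diff)
    \<comment> \<open>Both residuals are orthogonal to \<open>m' - m\<close>, and their difference
      is \<open>m' - m\<close> itself, which therefore has norm 0.\<close>
    then have "ip (x - m - (x - m')) (m' - m) = 0"
      unfolding ip_diff_left[of "x - m" "x - m'"] using * by simp
    then show "m = m'"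
      by (simp add: ip_self)
  qed
  from theI'[OF this] have "ip (x - orth_proj ip M x) y = 0"
    using assms(3) by (simp add: orth_proj_def)
  then have "ip y (x - orth_proj ip M x) = 0"
    using ip_eq_0_commute by blast
  then show ?thesis
    by (simp add: ip_diff_right)
qed

section \<open>Finitely many orthogonality constraints\<close>

text \<open>One linear condition lowers the dimension by at most one: a finite spanning set of the
  smaller space, with one vector \<open>v\<close> violating the condition, would span
  \<open>M\<close>.\<close>

lemma infinite_dimensional_Int_orthogonal:
  assumes "subspace M" "infinite_dimensional scl M"
  shows "subspace {y \<in> M. ip y z = 0}" "infinite_dimensional scl {y \<in> M. ip y z = 0}"
proof -
  let ?K = "{y \<in> M. ip y z = 0}"
  show sub: "subspace ?K"
    using assms(1)
    by (auto simp: subspace_def ip_zero_left ip_add_left ip_scale_left)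
  show "infinite_dimensional scl ?K"
    unfolding infinite_dimensional_def
  proof
    assume "\<exists>B. finite B \<and> B \<subseteq> ?K \<and> ?K = span B"
    then obtain B where B: "finite B" "B \<subseteq> ?K" "?K = span B"
      by blast
    have "\<exists>C. finite C \<and> C \<subseteq> M \<and> M = span C"
    proof (cases "M \<subseteq> ?K")
      case True
      then show ?thesis
        using B by blast
    next
      case False
      then obtain v where v: "v \<in> M" "ip v z \<noteq> 0"
        by blast
      have "y \<in> span (insert v B)" if "y \<in> M" for y
      proof -
        have "y - scl (ip y z / ip v z) v \<in> ?K"
          using that v assms(1)
          by (auto simp: ip_diff_left ip_scale_left intro: subspace_diff subspace_scale)
        then show ?thesis
          using B(3) by (auto simp: span_insert)
      qed
      moreover have "span (insert v B) \<subseteq> M"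
        using v B(2) assms(1) by (intro span_minimal) auto
      ultimately show ?thesis
        using v B(1,2) by (intro exI[of _ "insert v B"]) auto
    qed
    then show False
      using assms(2) by (simp add: infinite_dimensional_def)
  qed
qed

text \<open>Each constraint passes to a smaller infinite-dimensional subspace, so the induction
  needs \<open>M\<close> arbitrary; at the end, a space other than \<open>span {}\<close> has a
  nonzero vector.\<close>

lemma infinite_dimensional_orthogonal_exists:
  assumes "subspace M" "infinite_dimensional scl M"
  shows "\<exists>y\<in>M. y \<noteq> 0 \<and> (\<forall>n<N::nat. ip y (x n) = 0)"
  using assms
proof (induction N arbitrary: M)
  case 0
  have "M \<noteq> span {}"
    using 0(2) by (auto simp: infinite_dimensional_def)
  then show ?case
    using subspace_0[OF 0(1)] by auto
next
  case (Suc N)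
  from Suc.IH[OF infinite_dimensional_Int_orthogonal[OF Suc.prems, of "x N"]]
  show ?case
    by (auto simp: less_Suc_eq)
qed

end

theorem theorem3p21:
  fixes scl :: "'k::real_or_complex \<Rightarrow> 'h::banach \<Rightarrow> 'h"
    and ip :: "'h \<Rightarrow> 'h \<Rightarrow> 'k"
    and x :: "nat \<Rightarrow> 'h"
  assumes "hilbert_space scl ip"
    and "separable_space (euclidean :: 'h topology)"
    and "\<And>n. x n \<noteq> 0"
    and "(\<lambda>n. norm (x n)) \<longlonglongrightarrow> 0"
    and "\<exists>M. module.subspace scl M \<and> closed M \<and> infinite_dimensional scl M \<and>
           lower_frame_condition ip M (\<lambda>n. orth_proj ip M (x n))"
  shows "\<not> bessel_normalizable ip x"
proof
  assume "bessel_normalizable ip x"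
  then obtain B where B:
    "\<And>y. (\<Sum>n. ereal ((norm (ip y (x n /\<^sub>R norm (x n))))\<^sup>2)) \<le> ereal (B * (norm y)\<^sup>2)"
    by (auto simp: bessel_normalizable_def bessel_sequence_def)
  interpret hilbert_space scl ip by fact
  obtain M A where M: "subspace M" "closed M" "infinite_dimensional scl M" and A: "A > 0"
    and lower: "\<And>y. y \<in> M \<Longrightarrow>
      ereal (A * (norm y)\<^sup>2) \<le> (\<Sum>n. ereal ((norm (ip y (orth_proj ip M (x n))))\<^sup>2))"
    using assms(5) by (auto simp: lower_frame_condition_def)
  \<comment> \<open>The sign of \<open>B\<close> is unknown; \<open>\<bar>B\<bar> + 1\<close> keeps
    the denominator positive, and the 2 makes \<open>e * B < A\<close> strict.\<close>
  define e where "e = A / (2 * (\<bar>B\<bar> + 1))"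
  have e: "e > 0"
    using A by (simp add: e_def)
  have "e * B \<le> e * (\<bar>B\<bar> + 1)"
    using e by (intro mult_left_mono) auto
  also have "\<dots> = A / 2"
    by (simp add: e_def divide_simps)
  finally have eB: "e * B < A"
    using A by simp
  have "(\<lambda>n. (norm (x n))\<^sup>2) \<longlonglongrightarrow> 0"
    using tendsto_power[OF assms(4), of 2] by simp
  from order_tendstoD(2)[OF this e] obtain N where N: "\<And>n. n \<ge> N \<Longrightarrow> (norm (x n))\<^sup>2 < e"
    by (auto simp: eventually_sequentially)
  obtain y where y: "y \<in> M" "y \<noteq> 0" "\<And>n. n < N \<Longrightarrow> ip y (x n) = 0"
    using infinite_dimensional_orthogonal_exists[OF M(1,3), of N x] by blast
  \<comment> \<open>For \<open>n < N\<close> the left side is 0 by the choice of \<open>y\<close>;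
    afterwards, undoing the normalization costs the factor \<open>(norm (x n))\<^sup>2\<close>,
    which is below \<open>e\<close>.\<close>
  have termwise: "(norm (ip y (x n)))\<^sup>2 \<le> e * (norm (ip y (x n /\<^sub>R norm (x n))))\<^sup>2" for n
  proof (cases "n < N")
    case True
    then show ?thesis
      using y(3) e by simp
  next
    case False
    have "(norm (ip y (x n)))\<^sup>2 = (norm (x n))\<^sup>2 * (norm (ip y (x n /\<^sub>R norm (x n))))\<^sup>2"
      using assms(3)[of n] by (simp add: norm_ip_scaleR_right power_mult_distrib field_simps)
    also have "\<dots> \<le> e * (norm (ip y (x n /\<^sub>R norm (x n))))\<^sup>2"
      using N[of n] False by (intro mult_right_mono) auto
    finally show ?thesis .
  qed
  have "ereal (A * (norm y)\<^sup>2) \<le> (\<Sum>n. ereal ((norm (ip y (x n)))\<^sup>2))"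
    using lower[OF y(1)] by (simp add: ip_orth_proj[OF M(1,2) y(1)])
  also have "\<dots> \<le> (\<Sum>n. ereal e * ereal ((norm (ip y (x n /\<^sub>R norm (x n))))\<^sup>2))"
    using termwise by (intro suminf_le_pos) auto
  also have "\<dots> = ereal e * (\<Sum>n. ereal ((norm (ip y (x n /\<^sub>R norm (x n))))\<^sup>2))"
    using e by (intro suminf_cmult_ereal) auto
  also have "\<dots> \<le> ereal e * ereal (B * (norm y)\<^sup>2)"
    using B e by (intro ereal_mult_left_mono) auto
  \<comment> \<open>Both ends of the chain are finite, so it descends to the reals, where the
    positive \<open>(norm y)\<^sup>2\<close> cancels against \<open>e * B < A\<close>.\<close>
  finally have "A * (norm y)\<^sup>2 \<le> e * B * (norm y)\<^sup>2"
    by simp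
  then show False
    using eB y(2) by simp
qed

end
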